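(* Let $\mathbb P,\mathbb Q$ be two distributions on a generic measurable space $(\mathcal X,\mathcal F)$. Then $$\mathsf{TV}(\mathbb P,\mathbb Q)\le 2\sup\big\{\mathbb P(\mathcal C(X)=0)-\mathbb Q(\mathcal C(X)=0)\;:\;\mathbb P(\mathcal C(X)=0)=\mathbb Q(\mathcal C(X)=1)\big\},$$ where the supremum is over possibly randomized classifiers $\mathcal C:\mathcal X\to\{0,1\}$ satisfying the stated balance constraint. Moreover, the constant $2$ is tight, i.e. it cannot be replaced by any smaller constant valid for all pairs $\mathbb P,\mathbb Q$.
   Context: $\mathsf{TV}(\mathbb P,\mathbb Q)=\sup_{E\in\mathcal F}(\mathbb P(E)-\mathbb Q(E))$ is the total variation distance. A randomized classifier outputs, for each $x\in\mathcal X$, a Bernoulli random variable $\mathcal C(x)$ with measurable success probability in $x$, using randomness independent of $X$; $\mathbb P(\mathcal C(X)=a)$ and $\mathbb Q(\mathcal C(X)=a)$ denote the probability that $\mathcal C(X)=a$ when $X\sim\mathbb P$, respectively $X\sim\mathbb Q$. *)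

theory Defs
  imports "HOL-Probability.Probability"
begin

definition TV :: "'a measure \<Rightarrow> 'a measure \<Rightarrow> 'a measure \<Rightarrow> real" where
  "TV M P Q = (SUP E\<in>sets M. measure P E - measure Q E)"

text \<open>The labels 0 and 1 are \<open>False\<close> and \<open>True\<close>, and 1 is the success outcome. Every
  \<^typ>\<open>bool pmf\<close> is a Bernoulli law, so \<open>C x\<close> is the law of the classifier's output at \<open>x\<close>.\<close>

definition randomized_classifiers :: "'a measure \<Rightarrow> ('a \<Rightarrow> bool pmf) set" where
  "randomized_classifiers M = {C. (\<lambda>x. pmf (C x) True) \<in> borel_measurable M}"

text \<open>Since the internal randomness is independent of \<open>X\<close>, drawing \<open>X\<close> from \<open>P\<close> and then the
  output from \<open>C X\<close> is the monadic bind; \<open>output_prob P C a\<close> is the probability that the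
  output is \<open>a\<close>.\<close>

definition output_prob :: "'a measure \<Rightarrow> ('a \<Rightarrow> bool pmf) \<Rightarrow> bool \<Rightarrow> real" where
  "output_prob P C a = measure (P \<bind> (\<lambda>x. measure_pmf (C x))) {a}"

definition balanced_classifiers ::
    "'a measure \<Rightarrow> 'a measure \<Rightarrow> 'a measure \<Rightarrow> ('a \<Rightarrow> bool pmf) set" where
  "balanced_classifiers M P Q =
     {C \<in> randomized_classifiers M. output_prob P C False = output_prob Q C True}"

lemma classifier_kernel:
  assumes "C \<in> randomized_classifiers M"
  shows "(\<lambda>x. measure_pmf (C x)) \<in> measurable M (subprob_algebra (count_space UNIV))"
proof (rule measurable_subprob_algebra)
  fix A :: "bool set"
  have T: "(\<lambda>x. pmf (C x) True) \<in> borel_measurable M"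
    using assms by (simp add: randomized_classifiers_def)
  have F: "pmf (C x) False = 1 - pmf (C x) True" for x
    by (rule pmf_False_conv_True)
  have "(\<lambda>x. \<Sum>a\<in>A. pmf (C x) a) \<in> borel_measurable M"
  proof (rule borel_measurable_sum)
    show "(\<lambda>x. pmf (C x) a) \<in> borel_measurable M" for a
      using T by (cases a) (auto simp: F)
  qed
  then show "(\<lambda>x. emeasure (measure_pmf (C x)) A) \<in> borel_measurable M"
    by (simp add: measure_pmf.emeasure_eq_measure measure_measure_pmf_finite)
qed (auto intro: measure_pmf.subprob_space_axioms)

lemma output_prob_eq_integral:
  assumes "P \<in> space (prob_algebra M)" "C \<in> randomized_classifiers M"
  shows "output_prob P C a = (\<integral>x. pmf (C x) a \<partial>P)"
proof -
  interpret prob_space P using assms by (simp add: space_prob_algebra)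
  have "(\<lambda>x. measure_pmf (C x)) \<in> measurable P (subprob_algebra (count_space UNIV))"
    using classifier_kernel[OF assms(2)] assms(1)
    by (simp add: space_prob_algebra cong: measurable_cong_sets)
  from measure_bind[OF this, of "{a}"] show ?thesis
    by (simp add: output_prob_def pmf.rep_eq)
qed

text \<open>For probability measures \<open>P\<close> and \<open>Q\<close> on \<open>M\<close> the suprema above and in the theorem are
  taken over non-empty sets of reals bounded by 1.\<close>

lemma const_half_balanced:
  assumes "P \<in> space (prob_algebra M)" "Q \<in> space (prob_algebra M)"
  shows "(\<lambda>_. bernoulli_pmf (1/2)) \<in> balanced_classifiers M P Q"
proof -
  have c: "(\<lambda>_. bernoulli_pmf (1/2)) \<in> randomized_classifiers M"
    by (simp add: randomized_classifiers_def)
  have "prob_space P" "prob_space Q" using assms by (auto simp: space_prob_algebra)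
  then show ?thesis
    using c by (simp add: balanced_classifiers_def output_prob_eq_integral[OF assms(1) c]
      output_prob_eq_integral[OF assms(2) c] prob_space.prob_space)
qed

lemma bdd_above_output_diff:
  assumes "P \<in> space (prob_algebra M)"
  shows "bdd_above ((\<lambda>C. output_prob P C False - output_prob Q C False) `
           balanced_classifiers M P Q)"
proof (rule bdd_aboveI2)
  fix C assume "C \<in> balanced_classifiers M P Q"
  then have c: "C \<in> randomized_classifiers M" by (simp add: balanced_classifiers_def)
  interpret prob_space P using assms by (simp add: space_prob_algebra)
  have "output_prob P C False \<le> 1"
    unfolding output_prob_eq_integral[OF assms c]
    by (rule integral_le_const) (use c assms in \<open>auto intro!: integrable_const_bound[where B=1]
      simp: pmf_le_1 pmf_False_conv_True randomized_classifiers_def space_prob_algebra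
      cong: measurable_cong_sets\<close>)
  moreover have "0 \<le> output_prob Q C False" by (simp add: output_prob_def)
  ultimately show "output_prob P C False - output_prob Q C False \<le> 1" by simp
qed

end

theory Submission
  imports Defs
begin

text \<open>For an event \<open>E\<close> with \<open>s = P(E) + Q(E)\<close>, the classifier that outputs 0 with probability
  \<open>1/2 + (1_E - s/2)/2\<close> is balanced because the centred term integrates to 0 against \<open>P + Q\<close>,
  and it achieves exactly \<open>(P(E) - Q(E))/2\<close>. For tightness take \<open>P\<close> Bernoulli with small
  parameter \<open>p\<close> and \<open>Q\<close> the point mass at 0: then \<open>TV = p\<close>, while balance forces every
  classifier to achieve at most \<open>p/(2 - p)\<close>.\<close>

lemma exists_balanced_half_diff:
  assumes P: "P \<in> space (prob_algebra M)" and Q: "Q \<in> space (prob_algebra M)"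
    and E: "E \<in> sets M"
  shows "\<exists>C\<in>balanced_classifiers M P Q.
    output_prob P C False - output_prob Q C False = (measure P E - measure Q E) / 2"
proof -
  \<comment> \<open>The probability of output 0 is to be \<open>indicator E x / 2 + b\<close>.
    Balance then reads \<open>P(E)/2 + b = 1 - (Q(E)/2 + b)\<close>, which leaves this as the only
    choice of \<open>b\<close>.\<close>
  define b where "b = 1/2 - (measure P E + measure Q E) / 4"
  define C where "C x = bernoulli_pmf (1 - (indicator E x / 2 + b))" for x
  have Pp: "prob_space P" and Qp: "prob_space Q"
    and PM: "sets P = sets M" and QM: "sets Q = sets M"
    using P Q by (auto simp: space_prob_algebra)
  have "measure P E \<le> 1" "measure Q E \<le> 1"
    using Pp Qp by (auto intro: prob_space.prob_le_1)
  \<comment> \<open>These bounds keep \<open>indicator E x / 2 + b\<close> inside [0, 1] both on and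
    off \<open>E\<close>, so the Bernoulli parameter is a genuine probability.\<close>
  then have b: "0 \<le> b" "b \<le> 1/2" by (auto simp: b_def)
  have T: "pmf (C x) True = 1 - (indicator E x / 2 + b)" for x
    unfolding C_def using b by (subst pmf_bernoulli_True) (auto simp: indicator_def)
  have F: "pmf (C x) False = indicator E x / 2 + b" for x
    by (simp add: pmf_False_conv_True T)
  have C: "C \<in> randomized_classifiers M"
    using E by (simp add: randomized_classifiers_def T)
  have out: "output_prob R C False = measure R E / 2 + b"
    "output_prob R C True = 1 - (measure R E / 2 + b)" if R: "R \<in> space (prob_algebra M)" for R
  proof -
    interpret R: prob_space R using R by (simp add: space_prob_algebra)
    have ER: "E \<in> sets R" using E R by (simp add: space_prob_algebra)
    have *: "integrable R (\<lambda>x. indicator E x / 2 :: real)"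
      using ER by (intro integrable_divide integrable_real_indicator)
        (auto simp: R.emeasure_eq_measure)
    have eq: "(\<integral>x. indicator E x / 2 + b \<partial>R) = measure R E / 2 + b"
      using ER * by (simp add: R.prob_space)
    show "output_prob R C False = measure R E / 2 + b"
      using eq by (simp add: output_prob_eq_integral[OF R C] F)
    have "(\<integral>x. 1 - (indicator E x / 2 + b) \<partial>R) = 1 - (\<integral>x. indicator E x / 2 + b \<partial>R)"
      using * by (subst Bochner_Integration.integral_diff) (auto simp: R.prob_space)
    then show "output_prob R C True = 1 - (measure R E / 2 + b)"
      using eq by (simp add: output_prob_eq_integral[OF R C] T)
  qed
  have "C \<in> balanced_classifiers M P Q"
    using C by (simp add: balanced_classifiers_def out[OF P] out[OF Q]) (simp add: b_def field_simps)
  moreover have "output_prob P C False - output_prob Q C False = (measure P E - measure Q E) / 2"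
    by (simp add: out[OF P] out[OF Q])
  ultimately show ?thesis by blast
qed

lemma TV_le_twice_balanced_SUP:
  assumes P: "P \<in> space (prob_algebra M)" and Q: "Q \<in> space (prob_algebra M)"
  shows "TV M P Q \<le> 2 * (SUP C\<in>balanced_classifiers M P Q.
           output_prob P C False - output_prob Q C False)"
  unfolding TV_def
proof (rule cSUP_least)
  fix E assume "E \<in> sets M"
  from exists_balanced_half_diff[OF P Q this] obtain C
    where C: "C \<in> balanced_classifiers M P Q"
      "output_prob P C False - output_prob Q C False = (measure P E - measure Q E) / 2"
    by blast
  \<comment> \<open>A real supremum dominates its members only when the set is bounded above, hence
    the appeal to \<open>bdd_above_output_diff\<close>.\<close>
  have "output_prob P C False - output_prob Q C False
      \<le> (SUP C\<in>balanced_classifiers M P Q. output_prob P C False - output_prob Q C False)"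
    by (rule cSUP_upper[OF C(1) bdd_above_output_diff[OF P]])
  with C(2) show "measure P E - measure Q E \<le> 2 * (SUP C\<in>balanced_classifiers M P Q.
      output_prob P C False - output_prob Q C False)"
    by simp
qed auto

lemma diff_le_TV:
  assumes P: "P \<in> space (prob_algebra M)" and E: "E \<in> sets M"
  shows "measure P E - measure Q E \<le> TV M P Q"
  unfolding TV_def
proof (rule cSUP_upper[OF E bdd_aboveI2])
  have "prob_space P" using P by (simp add: space_prob_algebra)
  then show "measure P A - measure Q A \<le> 1" for A
    using prob_space.prob_le_1[of P A] measure_nonneg[of Q A] by linarith
qed

lemma measure_pmf_in_space_prob_algebra:
  "measure_pmf p \<in> space (prob_algebra (count_space UNIV))"
  by (simp add: space_prob_algebra measure_pmf.prob_space_axioms)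

text \<open>On two points a classifier amounts to its probabilities \<open>u\<close>,
  \<open>v\<close> of output 0 at \<open>True\<close> and at \<open>False\<close>. Its value is
  \<open>p * (u - v)\<close>, and balance ties \<open>u - v\<close> to \<open>u\<close> alone, so
  \<open>u \<le> 1\<close> caps the value.\<close>

lemma balanced_SUP_bernoulli_le:
  assumes p: "0 \<le> p" "p \<le> 1"
  defines "M \<equiv> count_space UNIV"
    and "P \<equiv> measure_pmf (bernoulli_pmf p)"
    and "Q \<equiv> measure_pmf (return_pmf False)"
  shows "(SUP C\<in>balanced_classifiers M P Q. output_prob P C False - output_prob Q C False)
    \<le> p / (2 - p)"
proof (rule cSUP_least)
  have P: "P \<in> space (prob_algebra M)" and Q: "Q \<in> space (prob_algebra M)"
    by (simp_all add: P_def Q_def M_def measure_pmf_in_space_prob_algebra)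
  show "balanced_classifiers M P Q \<noteq> {}"
    using const_half_balanced[OF P Q] by blast
  fix C assume "C \<in> balanced_classifiers M P Q"
  then have C: "C \<in> randomized_classifiers M" and bal: "output_prob P C False = output_prob Q C True"
    by (auto simp: balanced_classifiers_def)
  define u v where "u = pmf (C True) False" and "v = pmf (C False) False"
  have oP: "output_prob P C False = p * u + (1 - p) * v"
    unfolding output_prob_eq_integral[OF P C] unfolding P_def using p by (simp add: u_def v_def)
  have oQ: "output_prob Q C a = pmf (C False) a" for a
    unfolding output_prob_eq_integral[OF Q C] unfolding Q_def
    by (subst integral_measure_pmf[of "{False}"]) auto
  have "p * u + (1 - p) * v = 1 - v"
    using bal by (simp add: oP oQ v_def pmf_False_conv_True)
  \<comment> \<open>Balance says \<open>p * u + (2 - p) * v = 1\<close>; subtracting this from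
    \<open>p * u + (2 - p) * u = 2 * u\<close> eliminates \<open>v\<close> on the right.\<close>
  then have "(2 - p) * (u - v) = 2 * u - 1" by (simp add: algebra_simps)
  also have "\<dots> \<le> 1" by (simp add: u_def pmf_le_1)
  finally have "u - v \<le> 1 / (2 - p)" using p by (simp add: field_simps)
  then have "p * (u - v) \<le> p * (1 / (2 - p))" using p by (intro mult_left_mono) auto
  then show "output_prob P C False - output_prob Q C False \<le> p / (2 - p)"
    using oP oQ[of False] by (simp add: v_def[symmetric] algebra_simps)
qed

lemma exists_TV_gt_balanced_SUP:
  assumes "c < 2"
  shows "\<exists>(M :: bool measure) P Q. P \<in> space (prob_algebra M) \<and> Q \<in> space (prob_algebra M) \<and>
    c * (SUP C\<in>balanced_classifiers M P Q. output_prob P C False - output_prob Q C False)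
      < TV M P Q"
proof -
  \<comment> \<open>Raising \<open>c\<close> to at least 1 makes \<open>p\<close> at most 1/2, hence
    a valid parameter even for negative \<open>c\<close>. Taking half the gap \<open>2 - d\<close>
    gives \<open>d < 2 - p\<close> strictly, which is what turns \<open>d * p / (2 - p)\<close> into
    less than \<open>p\<close>.\<close>
  define d where "d = max c 1"
  define p where "p = (2 - d) / 2"
  have d: "1 \<le> d" "c \<le> d" "d < 2" using assms by (auto simp: d_def)
  then have p: "0 < p" "p \<le> 1" "d < 2 - p" by (auto simp: p_def field_simps)
  define M :: "bool measure" where "M = count_space UNIV"
  define P where "P = measure_pmf (bernoulli_pmf p)"
  define Q where "Q = measure_pmf (return_pmf False)"
  define S where "S = (SUP C\<in>balanced_classifiers M P Q.
    output_prob P C False - output_prob Q C False)"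
  have P: "P \<in> space (prob_algebra M)" and Q: "Q \<in> space (prob_algebra M)"
    by (simp_all add: P_def Q_def M_def measure_pmf_in_space_prob_algebra)
  \<comment> \<open>The event \<open>{True}\<close> has mass \<open>p\<close> under \<open>P\<close>
    and 0 under \<open>Q\<close>; a lower bound on \<open>TV\<close> suffices here.\<close>
  have TV: "p \<le> TV M P Q"
    using diff_le_TV[OF P, of "{True}" Q] p
    by (simp add: P_def Q_def M_def measure_pmf_single)
  have S: "S \<le> p / (2 - p)"
    using balanced_SUP_bernoulli_le[of p] p by (simp add: S_def P_def Q_def M_def)
  \<comment> \<open>The empty event yields a balanced classifier of value 0. Hence \<open>S\<close>
    is nonnegative, and replacing \<open>c\<close> by the larger \<open>d\<close> can only increase
    the product with \<open>S\<close>.\<close>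
  have "{} \<in> sets M" by simp
  from exists_balanced_half_diff[OF P Q this] obtain C where "C \<in> balanced_classifiers M P Q"
    "output_prob P C False - output_prob Q C False = 0" by auto
  then have S0: "0 \<le> S"
    unfolding S_def using cSUP_upper[OF _ bdd_above_output_diff[OF P]] by metis
  have "c * S \<le> d * S" using d S0 by (intro mult_right_mono)
  also have "\<dots> \<le> d * (p / (2 - p))" using d S by (intro mult_left_mono) auto
  also have "\<dots> = d * p / (2 - p)" by simp
  also have "\<dots> < p"
    using p mult_strict_left_mono[OF p(3) p(1)] by (simp add: pos_divide_less_eq mult.commute)
  also note TV
  finally show ?thesis using P Q unfolding S_def by blast
qed

theorem proposition1:
  "(\<forall>(M :: 'a measure) P Q.
      P \<in> space (prob_algebra M) \<longrightarrow> Q \<in> space (prob_algebra M) \<longrightarrow>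
      TV M P Q \<le> 2 * (SUP C\<in>balanced_classifiers M P Q.
                        output_prob P C False - output_prob Q C False)) \<and>
   \<not> (\<exists>c<2. \<forall>(M :: bool measure) P Q.
      P \<in> space (prob_algebra M) \<longrightarrow> Q \<in> space (prob_algebra M) \<longrightarrow>
      TV M P Q \<le> c * (SUP C\<in>balanced_classifiers M P Q.
                        output_prob P C False - output_prob Q C False))"
proof (intro conjI notI allI impI)
  assume "\<exists>c<2. \<forall>(M :: bool measure) P Q.
      P \<in> space (prob_algebra M) \<longrightarrow> Q \<in> space (prob_algebra M) \<longrightarrow>
      TV M P Q \<le> c * (SUP C\<in>balanced_classifiers M P Q.
                        output_prob P C False - output_prob Q C False)"
  then show False using exists_TV_gt_balanced_SUP by (meson not_le)
qed (rule TV_le_twice_balanced_SUP)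

end
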